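(* For every positive integer $\nu$ there exists a constant $c_\nu>0$, depending only on $\nu$, such that for every integer $N\ge1$ and every real $T>0$, $$c_\nu(\log N)^{\nu^2}\le\frac{1}{2T}\int_{|t|\le T}\Bigl|\sum_{n=1}^N\frac{1}{n^{\frac12+it}}\Bigr|^{2\nu}dt .$$ *)

theory Defs
  imports "HOL-Analysis.Analysis"
begin

end

theory Submission
  imports Defs "HOL-Number_Theory.Cong"
begin

text \<open>
  Write $D(t)$ for the Dirichlet polynomial. Expanding $|D(t)|^{2\nu} = |D(t)^\nu|^2$ gives a sum of
  terms $w\cos(\lambda t)$ with nonnegative weights $w$, one for each pair of $\nu$-tuples
  $(f, g)$ of numbers in $[1, N]$, with frequency $\lambda = \log(\prod g / \prod f)$. As
  $|D|^{2\nu} \ge 0$, its integral over $[-T, T]$ decreases when the Fejer weight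
  $1 - |t|/T$ is inserted; against that weight each $\cos(\lambda t)$ has nonnegative integral,
  and the terms of frequency $0$ contribute fully. So for every $T > 0$, however small, the mean
  value is at least half of the diagonal sum
  \[ \sum_{\prod f = \prod g} \frac{1}{\prod f} \]
  (lemma \<open>power_mean_ge_diagonal\<close>).

  It remains to see that the diagonal sum is $\gg (\log N)^{\nu^2}$. A $\nu \times \nu$ matrix of
  positive integers yields a pair $(f, g)$ with equal products: its row products and its column
  products. If the entries are pairwise coprime, the entry $(i, j)$ is recovered as
  $\gcd(f_i, g_j)$, so distinct coprime matrices yield distinct pairs, and the diagonal sum is at
  least the sum of $\prod 1/x_{ij}$ over coprime matrices with entries at most
  $M = \lfloor N^{1/\nu} \rfloor$ (lemma \<open>coprime_matrices_le_diagonal\<close>).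

  To bound this from below with $k = \nu^2$ entries, take all entries congruent to $1$ modulo
  $Q = (2k^2)!$. Let $H$ be the sum of $1/x$ over the admissible $x \le M$; it is at
  least $\log(M+1)/Q$. Two entries that are not coprime have a common divisor $d > 2k^2$, because
  they are coprime to $Q$. The multiples of $d$ contribute at most $H/d$ to $H$, hence tuples in
  which two given entries share a divisor contribute at most
  $\sum_{d > 2k^2} H^k/d^2 \le H^k/(2k^2)$, and all of the at most $k^2$ pairs of entries together
  spoil at most half of the full sum $H^k$ (lemma \<open>pairwise_coprime_tuples_ge\<close>).
\<close>

section \<open>Lower bounds for means of nonnegative cosine sums\<close>

text \<open>
  The cosine transform of the Fejer weight; the point is its sign, as $1 - \cos(lT) \ge 0$.
\<close>

lemma has_integral_fejer_cos:
  fixes T l :: real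
  assumes "T > 0" "l \<noteq> 0"
  shows "((\<lambda>t. (1 - \<bar>t\<bar> / T) * cos (l * t)) has_integral 2 * ((1 - cos (l * T)) / (l\<^sup>2 * T))) {-T..T}"
proof -
  let ?f = "\<lambda>t. (1 - \<bar>t\<bar> / T) * cos (l * t)"
  let ?G = "\<lambda>t. (1 - t / T) * sin (l * t) / l - cos (l * t) / (l\<^sup>2 * T)"
  have "((\<lambda>t. (1 - t / T) * cos (l * t)) has_integral (?G T - ?G 0)) {0..T}"
    using assms
    by (intro fundamental_theorem_of_calculus)
       (auto intro!: derivative_eq_intros
             simp flip: has_real_derivative_iff_has_vector_derivative
             simp: field_simps power2_eq_square)
  then have "((\<lambda>t. (1 - t / T) * cos (l * t)) has_integral (1 - cos (l * T)) / (l\<^sup>2 * T)) {0..T}"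
    using assms by (simp add: diff_divide_distrib)
  then have right: "(?f has_integral (1 - cos (l * T)) / (l\<^sup>2 * T)) {0..T}"
    by (rule has_integral_eq[rotated]) auto
  then have "((\<lambda>t. ?f (- t)) has_integral (1 - cos (l * T)) / (l\<^sup>2 * T)) {-T..-0}"
    by (subst has_integral_reflect_real) auto
  then have left: "(?f has_integral (1 - cos (l * T)) / (l\<^sup>2 * T)) {-T..0}"
    by simp
  show ?thesis
    using has_integral_combine[OF _ _ left right] assms by (simp add: mult.commute)
qed

lemma integral_fejer:
  fixes T :: real
  assumes "T > 0"
  shows "integral {-T..T} (\<lambda>t. 1 - \<bar>t\<bar> / T) = T"
proof -
  let ?f = "\<lambda>t. 1 - \<bar>t\<bar> / T"
  let ?G = "\<lambda>t. t - t\<^sup>2 / (2 * T)"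
  have "((\<lambda>t. 1 - t / T) has_integral (?G T - ?G 0)) {0..T}"
    using assms
    by (intro fundamental_theorem_of_calculus)
       (auto intro!: derivative_eq_intros
             simp flip: has_real_derivative_iff_has_vector_derivative)
  then have "((\<lambda>t. 1 - t / T) has_integral T / 2) {0..T}"
    using assms by (simp add: power2_eq_square)
  then have right: "(?f has_integral T / 2) {0..T}"
    by (rule has_integral_eq[rotated]) auto
  then have "((\<lambda>t. ?f (- t)) has_integral T / 2) {-T..-0}"
    by (subst has_integral_reflect_real) auto
  then have left: "(?f has_integral T / 2) {-T..0}"
    by simp
  show ?thesis
    using has_integral_combine[OF _ _ left right] assms by (simp add: integral_unique)
qed

text \<open>
  The Fejer weight is at most $1$ on $[-T, T]$ and its cosine transform is nonnegative. Hence
  inserting it can only decrease the integral of the nonnegative function $F$, and afterwards every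
  term of nonzero frequency may be dropped. The factor $1/2$ is the mean of the weight.
\<close>

lemma mean_nonneg_cosine_sum_ge:
  fixes w l :: "'a \<Rightarrow> real" and T :: real
  assumes fin: "finite I" and w: "\<And>i. i \<in> I \<Longrightarrow> w i \<ge> 0"
    and F: "\<And>t. F t = (\<Sum>i\<in>I. w i * cos (l i * t))" and pos: "\<And>t. F t \<ge> 0"
    and T: "T > 0"
  shows "(1/2) * (\<Sum>i | i \<in> I \<and> l i = 0. w i) \<le> 1 / (2 * T) * integral {-T..T} F"
proof -
  let ?k = "\<lambda>t. 1 - \<bar>t\<bar> / T"
  let ?K = "\<lambda>i. integral {-T..T} (\<lambda>t. ?k t * cos (l i * t))"
  have K: "?K i \<ge> (if l i = 0 then T else 0)" for i
  proof (cases "l i = 0")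
    case True
    then show ?thesis using integral_fejer[OF T] by simp
  next
    case False
    then show ?thesis
      using integral_unique[OF has_integral_fejer_cos[OF T False]] T by simp
  qed
  have int: "(\<lambda>t. ?k t * cos (l i * t)) integrable_on {-T..T}" for i
    using T by (intro integrable_continuous_real continuous_intros) auto
  have intF: "F integrable_on {-T..T}"
    unfolding F[abs_def] by (intro integrable_continuous_real continuous_intros)
  have intkF: "(\<lambda>t. ?k t * F t) integrable_on {-T..T}"
    unfolding F[abs_def] using T by (intro integrable_continuous_real continuous_intros) auto
  have "T * (\<Sum>i | i \<in> I \<and> l i = 0. w i) = (\<Sum>i\<in>I. w i * (if l i = 0 then T else 0))"
    using fin by (simp add: sum_distrib_left sum.inter_filter if_distrib mult.commute cong: if_cong)
  also have "\<dots> \<le> (\<Sum>i\<in>I. w i * ?K i)"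
    using w K by (intro sum_mono mult_left_mono) auto
  also have "\<dots> = integral {-T..T} (\<lambda>t. \<Sum>i\<in>I. w i * (?k t * cos (l i * t)))"
    using fin int by (subst integral_sum) (auto intro!: integrable_on_mult_right)
  also have "\<dots> = integral {-T..T} (\<lambda>t. ?k t * F t)"
    by (simp add: F sum_distrib_left mult_ac)
  also have "\<dots> \<le> integral {-T..T} F"
  proof (rule integral_le[OF intkF intF])
    fix t assume "t \<in> {-T..T}"
    then have "?k t \<le> 1" using T by simp
    then show "?k t * F t \<le> F t"
      using mult_right_mono[of "?k t" 1 "F t"] pos[of t] by simp
  qed
  finally show ?thesis
    using T by (simp add: field_simps)
qed

section \<open>Powers of the Dirichlet polynomial\<close>

lemma cmod_sum_cis_squared:
  "(cmod (\<Sum>i\<in>P. complex_of_real (w i) * cis (\<theta> i)))\<^sup>2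
     = (\<Sum>(i, j)\<in>P \<times> P. w i * w j * cos (\<theta> i - \<theta> j))"
proof -
  let ?z = "\<Sum>i\<in>P. complex_of_real (w i) * cis (\<theta> i)"
  have "(cmod ?z)\<^sup>2 = Re (?z * cnj ?z)"
    by (simp only: complex_norm_square[symmetric] Re_complex_of_real)
  also have "?z * cnj ?z = (\<Sum>i\<in>P. \<Sum>j\<in>P. complex_of_real (w i * w j) * cis (\<theta> i - \<theta> j))"
    unfolding cnj_sum sum_product
  proof (intro sum.cong refl)
    fix i j
    have "cis (\<theta> i - \<theta> j) = cis (\<theta> i) * cis (- \<theta> j)"
      by (simp add: cis_mult)
    then show "complex_of_real (w i) * cis (\<theta> i) * cnj (complex_of_real (w j) * cis (\<theta> j))
        = complex_of_real (w i * w j) * cis (\<theta> i - \<theta> j)"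
      by (simp add: cis_cnj)
  qed
  also have "Re \<dots> = (\<Sum>i\<in>P. \<Sum>j\<in>P. w i * w j * cos (\<theta> i - \<theta> j))"
    by simp
  finally show ?thesis
    by (simp add: sum.cartesian_product)
qed

lemma dirichlet_term_polar:
  fixes n :: nat
  assumes "n > 0"
  shows "1 / (of_nat n powr (1 / 2 + \<i> * of_real t))
    = complex_of_real (1 / sqrt (real n)) * cis (- ln (real n) * t)"
proof -
  have "of_nat n powr (1 / 2 + \<i> * of_real t) = exp ((1 / 2 + \<i> * of_real t) * complex_of_real (ln (real n)))"
    using assms by (simp add: powr_def Ln_of_nat)
  also have "\<dots> = exp (complex_of_real (ln (real n) / 2)) * exp (\<i> * complex_of_real (ln (real n) * t))"
    by (simp add: exp_add[symmetric] algebra_simps)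
  also have "exp (complex_of_real (ln (real n) / 2)) = complex_of_real (sqrt (real n))"
  proof -
    have "exp (ln (real n) / 2) = sqrt (real n)"
      using assms by (simp add: ln_sqrt[symmetric])
    then show ?thesis by (simp only: exp_of_real)
  qed
  also have "exp (\<i> * complex_of_real (ln (real n) * t)) = cis (ln (real n) * t)"
    by (simp add: cis_conv_exp)
  finally have powr_eq: "of_nat n powr (1 / 2 + \<i> * of_real t)
    = complex_of_real (sqrt (real n)) * cis (ln (real n) * t)" .
  show ?thesis
    unfolding powr_eq by (simp add: divide_inverse)
qed

lemma prod_polar_terms:
  fixes f :: "'a \<Rightarrow> nat"
  assumes "finite I" "\<And>i. i \<in> I \<Longrightarrow> f i > 0"
  shows "(\<Prod>i\<in>I. complex_of_real (1 / sqrt (real (f i))) * cis (- ln (real (f i)) * t))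
    = complex_of_real (1 / sqrt (real (\<Prod>i\<in>I. f i))) * cis (- ln (real (\<Prod>i\<in>I. f i)) * t)"
  using assms
proof (induction I rule: finite_induct)
  case (insert a I)
  have pos: "0 < (\<Prod>i\<in>I. f i)" using insert.prems by (intro prod_pos) auto
  have "(\<Prod>i\<in>insert a I. complex_of_real (1 / sqrt (real (f i))) * cis (- ln (real (f i)) * t))
     = (complex_of_real (1 / sqrt (real (f a))) * cis (- ln (real (f a)) * t)) *
       (complex_of_real (1 / sqrt (real (\<Prod>i\<in>I. f i))) * cis (- ln (real (\<Prod>i\<in>I. f i)) * t))"
    using insert by simp
  also have "\<dots> = complex_of_real (1 / sqrt (real (f a)) * (1 / sqrt (real (\<Prod>i\<in>I. f i)))) *
      (cis (- ln (real (f a)) * t) * cis (- ln (real (\<Prod>i\<in>I. f i)) * t))"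
    by (simp only: of_real_mult mult_ac)
  also have "1 / sqrt (real (f a)) * (1 / sqrt (real (\<Prod>i\<in>I. f i))) = 1 / sqrt (real (\<Prod>i\<in>insert a I. f i))"
    using insert.hyps by (simp add: real_sqrt_mult)
  also have "cis (- ln (real (f a)) * t) * cis (- ln (real (\<Prod>i\<in>I. f i)) * t)
      = cis (- ln (real (\<Prod>i\<in>insert a I. f i)) * t)"
    using insert.hyps insert.prems pos
    by (simp add: cis_mult ln_mult ring_distribs del: of_nat_prod)
  finally show ?case .
qed simp

text \<open>
  The frequency of the pair $(f, g)$ vanishes exactly when $f$ and $g$ have equal products, so the
  zero-frequency terms form the diagonal sum.
\<close>

lemma power_mean_ge_diagonal:
  fixes N \<nu> :: nat and T :: real
  assumes T: "T > 0"
  defines "P \<equiv> {..<\<nu>} \<rightarrow>\<^sub>E {1..N}"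
  shows "(1/2) * (\<Sum>(f, g) | (f, g) \<in> P \<times> P \<and> prod f {..<\<nu>} = prod g {..<\<nu>}. 1 / real (prod f {..<\<nu>}))
    \<le> 1 / (2 * T) * integral {-T..T}
          (\<lambda>t. (cmod (\<Sum>n=1..N. 1 / (of_nat n powr (1 / 2 + \<i> * of_real t)))) ^ (2 * \<nu>))"
proof -
  let ?m = "\<lambda>f::nat\<Rightarrow>nat. prod f {..<\<nu>}"
  let ?w = "\<lambda>p. 1 / sqrt (real (?m (fst p))) * (1 / sqrt (real (?m (snd p))))"
  let ?l = "\<lambda>p. ln (real (?m (snd p))) - ln (real (?m (fst p)))"
  let ?F = "\<lambda>t. (cmod (\<Sum>n=1..N. 1 / (of_nat n powr (1 / 2 + \<i> * of_real t)))) ^ (2 * \<nu>)"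
  have finP: "finite P" unfolding P_def by (intro finite_PiE) auto
  have mpos: "?m f > 0" if "f \<in> P" for f
  proof (rule prod_pos)
    fix i assume "i \<in> {..<\<nu>}"
    then have "f i \<in> {1..N}" using that unfolding P_def by blast
    then show "f i > 0" by simp
  qed
  have w: "?w p \<ge> 0" for p
    by (simp del: of_nat_prod)
  have F: "?F t = (\<Sum>p\<in>P \<times> P. ?w p * cos (?l p * t))" for t
  proof -
    have "(\<Sum>n=1..N. 1 / (of_nat n powr (1 / 2 + \<i> * of_real t))) ^ \<nu>
      = (\<Prod>i<\<nu>. \<Sum>n=1..N. complex_of_real (1 / sqrt (real n)) * cis (- ln (real n) * t))"
      by (simp add: dirichlet_term_polar)
    also have "\<dots> = (\<Sum>f\<in>P. \<Prod>i<\<nu>. complex_of_real (1 / sqrt (real (f i))) * cis (- ln (real (f i)) * t))"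
      unfolding P_def by (subst prod_sum_PiE) auto
    also have "\<dots> = (\<Sum>f\<in>P. complex_of_real (1 / sqrt (real (?m f))) * cis (- ln (real (?m f)) * t))"
    proof (intro sum.cong refl prod_polar_terms)
      fix f i assume "f \<in> P" "i \<in> {..<\<nu>}"
      then have "f i \<in> {1..N}" unfolding P_def by blast
      then show "f i > 0" by simp
    qed simp
    finally have power_eq: "(\<Sum>n=1..N. 1 / (of_nat n powr (1 / 2 + \<i> * of_real t))) ^ \<nu> =
      (\<Sum>f\<in>P. complex_of_real (1 / sqrt (real (?m f))) * cis (- ln (real (?m f)) * t))" .
    have "cmod z ^ (2 * \<nu>) = (cmod (z ^ \<nu>))\<^sup>2" for z
      by (simp add: norm_power power_mult[symmetric] mult.commute)
    then have "?F t = (cmod (\<Sum>f\<in>P. complex_of_real (1 / sqrt (real (?m f))) * cis (- ln (real (?m f)) * t)))\<^sup>2"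
      by (simp only: power_eq)
    also have "\<dots> = (\<Sum>(f, g)\<in>P \<times> P. 1 / sqrt (real (?m f)) * (1 / sqrt (real (?m g)))
        * cos (- ln (real (?m f)) * t - - ln (real (?m g)) * t))"
      by (rule cmod_sum_cis_squared)
    finally show ?thesis
      by (simp add: case_prod_unfold algebra_simps)
  qed
  have "(1/2) * (\<Sum>p | p \<in> P \<times> P \<and> ?l p = 0. ?w p) \<le> 1 / (2 * T) * integral {-T..T} ?F"
    using finP w by (intro mean_nonneg_cosine_sum_ge[OF _ _ F _ T]) auto
  also have "(\<Sum>p | p \<in> P \<times> P \<and> ?l p = 0. ?w p)
    = (\<Sum>(f, g) | (f, g) \<in> P \<times> P \<and> ?m f = ?m g. 1 / real (?m f))"
  proof (intro sum.cong)
    show "{p. p \<in> P \<times> P \<and> ?l p = 0} = {(f, g). (f, g) \<in> P \<times> P \<and> ?m f = ?m g}"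
      using mpos by (auto simp del: of_nat_prod)
  qed (auto simp: case_prod_unfold simp del: of_nat_prod)
  finally show ?thesis .
qed

section \<open>Pairwise coprime tuples in a residue class\<close>

definition class_one :: "nat \<Rightarrow> nat \<Rightarrow> nat set" where
  "class_one Q M = {x \<in> {1..M}. [x = 1] (mod Q)}"

text \<open>
  The element of the class of $1$ in the block of $Q$ consecutive integers
  $1 + Qj, \dots, Q + Qj$ that contains $z$. Replacing $z$ by it never decreases $1/z$; this is how
  sums over other sets of integers are compared with the sum over the class.
\<close>

definition class_rep :: "nat \<Rightarrow> nat \<Rightarrow> nat" where
  "class_rep Q z = 1 + Q * ((z - 1) div Q)"

lemma finite_class_one [simp]: "finite (class_one Q M)"
  by (simp add: class_one_def)

lemma class_rep_le: "z \<ge> 1 \<Longrightarrow> class_rep Q z \<le> z"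
  unfolding class_rep_def using mult_div_mod_eq[of Q "z - 1"] by linarith

lemma class_rep_in: "z \<in> {1..M} \<Longrightarrow> class_rep Q z \<in> class_one Q M"
proof -
  assume z: "z \<in> {1..M}"
  have "[class_rep Q z = 1] (mod Q)"
    by (simp only: class_rep_def cong_def mod_mult_self2)
  then show ?thesis
    using z class_rep_le[of z Q] by (simp add: class_one_def) (simp add: class_rep_def)
qed

lemma less_class_rep_add: "Q > 0 \<Longrightarrow> z < class_rep Q z + Q"
  unfolding class_rep_def using mult_div_mod_eq[of Q "z - 1"] mod_less_divisor[of Q "z - 1"]
  by linarith

text \<open>
  Rounding down to the class of $1$ does not decrease any reciprocal and is at most $Q$-to-one.
\<close>

lemma harm_le_class_sum:
  assumes "Q > 0"
  shows "harm M \<le> real Q * (\<Sum>a\<in>class_one Q M. 1 / real a)"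
proof -
  let ?A = "class_one Q M"
  have fib: "real (card {x \<in> {1..M}. class_rep Q x = a}) \<le> real Q" for a
  proof -
    have "{x \<in> {1..M}. class_rep Q x = a} \<subseteq> {a..<a + Q}"
      using class_rep_le less_class_rep_add[OF assms] by fastforce
    from card_mono[OF _ this] show ?thesis by simp
  qed
  have "harm M \<le> (\<Sum>x=1..M. 1 / real (class_rep Q x))"
    unfolding harm_def
  proof (rule sum_mono)
    fix x assume "x \<in> {1..M}"
    then show "inverse (real x) \<le> 1 / real (class_rep Q x)"
      using class_rep_le[of x Q] by (auto simp: field_simps class_rep_def simp flip: of_nat_mult of_nat_add)
  qed
  also have "\<dots> = (\<Sum>a\<in>?A. \<Sum>x | x \<in> {1..M} \<and> class_rep Q x = a. 1 / real (class_rep Q x))"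
    using class_rep_in by (intro sum.group[symmetric]) auto
  also have "\<dots> = (\<Sum>a\<in>?A. real (card {x \<in> {1..M}. class_rep Q x = a}) * (1 / real a))"
    by (intro sum.cong) auto
  also have "\<dots> \<le> (\<Sum>a\<in>?A. real Q * (1 / real a))"
    using fib by (intro sum_mono mult_right_mono) auto
  finally show ?thesis by (simp add: sum_distrib_left)
qed

text \<open>
  If $a = dz$ lies in the class of $1$, then $z$ lies in the class of the inverse of $d$ modulo $Q$.
  A single residue class meets each block of $Q$ integers once, so rounding $z$ down to the class of
  $1$ is injective, and $1/a$ is at most $1/d$ times the reciprocal of the rounded value. If $d$ is
  not invertible modulo $Q$, there is no such $a$. Starting the blocks at $1$ is what gives the clean factor
  $1/d$ with no error term.
\<close>

lemma class_sum_multiples_le: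
  assumes "Q > 0" "d > 0"
  shows "(\<Sum>a | a \<in> class_one Q M \<and> d dvd a. 1 / real a)
    \<le> (\<Sum>a\<in>class_one Q M. 1 / real a) * (1 / real d)"
proof -
  let ?A = "class_one Q M"
  define B where "B = {a \<in> ?A. d dvd a}"
  define \<phi> where "\<phi> a = class_rep Q (a div d)" for a
  have B: "a div d \<in> {1..M}" "a = d * (a div d)" "[d * (a div d) = 1] (mod Q)" if "a \<in> B" for a
  proof -
    have a: "a \<in> {1..M}" "[a = 1] (mod Q)" "d dvd a" using that by (auto simp: B_def class_one_def)
    then show "a = d * (a div d)" by simp
    with a(2) show "[d * (a div d) = 1] (mod Q)" by simp
    have "a div d \<ge> 1" using a assms by (auto simp: Suc_le_eq div_greater_zero_iff dvd_imp_le)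
    then show "a div d \<in> {1..M}" using a div_le_dividend[of a d] by (simp del: div_le_dividend)
  qed
  have inj: "inj_on \<phi> B"
  proof (rule inj_onI)
    fix a b assume ab: "a \<in> B" "b \<in> B" "\<phi> a = \<phi> b"
    let ?y = "a div d" and ?z = "b div d"
    \<comment> \<open>Evaluate the product of the two quotients and \<open>d\<close> in two ways: \<open>d\<close> cancels modulo \<open>Q\<close>.\<close>
    have "[?y * (d * ?z) = ?y * 1] (mod Q)" "[?z * (d * ?y) = ?z * 1] (mod Q)"
      using B(3) ab by (blast intro: cong_scalar_left)+
    then have "[?y = ?z] (mod Q)"
      by (metis cong_sym cong_trans mult.left_commute mult.commute mult.right_neutral)
    then have "[(?y - 1) + 1 = (?z - 1) + 1] (mod Q)"
      using B(1)[OF ab(1)] B(1)[OF ab(2)] by simp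
    then have "(?y - 1) mod Q = (?z - 1) mod Q"
      by (simp only: cong_add_rcancel_nat) (simp add: cong_def)
    moreover have "(?y - 1) div Q = (?z - 1) div Q"
      using ab(3) assms by (simp add: \<phi>_def class_rep_def)
    ultimately have "?y - 1 = ?z - 1" by (metis div_mult_mod_eq)
    then have "?y = ?z"
      using B(1)[OF ab(1)] B(1)[OF ab(2)] unfolding atLeastAtMost_iff by linarith
    then show "a = b" using B(2) ab by metis
  qed
  have "(\<Sum>a\<in>B. 1 / real a) \<le> (\<Sum>a\<in>B. 1 / real (\<phi> a) * (1 / real d))"
  proof (rule sum_mono)
    fix a assume a: "a \<in> B"
    have "\<phi> a \<le> a div d" using class_rep_le B(1)[OF a] by (simp add: \<phi>_def)
    then have "d * \<phi> a \<le> a" using B(2)[OF a] by (metis mult_le_mono2)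
    then have "real d * real (\<phi> a) \<le> real a" by (metis of_nat_le_iff of_nat_mult)
    moreover have "\<phi> a > 0" by (simp add: \<phi>_def class_rep_def)
    then have "real d * real (\<phi> a) > 0" using assms by simp
    ultimately have "1 / real a \<le> 1 / (real d * real (\<phi> a))" by (intro divide_left_mono) auto
    then show "1 / real a \<le> 1 / real (\<phi> a) * (1 / real d)" by (simp add: mult.commute)
  qed
  also have "\<dots> = (\<Sum>a\<in>\<phi> ` B. 1 / real a) * (1 / real d)"
    by (simp only: sum.reindex[OF inj] sum_distrib_right comp_def)
  also have "\<dots> \<le> (\<Sum>a\<in>?A. 1 / real a) * (1 / real d)"
    using class_rep_in B(1) by (intro mult_right_mono sum_mono2) (auto simp: \<phi>_def)
  finally show ?thesis by (simp add: B_def)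
qed

text \<open>
  Telescoping, with $1/(n+1)^2 \le 1/n - 1/(n+1)$.
\<close>

lemma sum_inverse_squares_le:
  assumes "y \<ge> 1"
  shows "(\<Sum>d\<in>{y<..M}. 1 / (real d)\<^sup>2) \<le> 1 / real y"
proof (cases "y \<le> M")
  case True
  then have "(\<Sum>d\<in>{y<..M}. 1 / (real d)\<^sup>2) \<le> 1 / real y - 1 / real M"
  proof (induction M rule: dec_induct)
    case (step n)
    have n: "real n \<ge> 1" using assms step.hyps by simp
    have "{y<..Suc n} = insert (Suc n) {y<..n}" using step.hyps by auto
    then have "(\<Sum>d\<in>{y<..Suc n}. 1 / (real d)\<^sup>2) \<le> 1 / (real n + 1)\<^sup>2 + (1 / real y - 1 / real n)"
      using step.IH by (simp add: add.commute)
    moreover have "1 / (real n + 1)\<^sup>2 \<le> 1 / real n - 1 / (real n + 1)"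
    proof -
      have "1 / (real n + 1)\<^sup>2 \<le> 1 / (real n * (real n + 1))"
        using n by (intro divide_left_mono) (auto simp: power2_eq_square)
      also have "\<dots> = 1 / real n - 1 / (real n + 1)"
        using n by (simp add: field_simps)
      finally show ?thesis .
    qed
    ultimately show ?case by (simp add: add.commute)
  qed simp
  moreover have "1 / real M \<ge> 0" by simp
  ultimately show ?thesis by linarith
qed simp

text \<open>
  Every number up to $y$ divides $y!$, and an element of the class of $1$ is coprime to the modulus.
\<close>

lemma common_divisor_large:
  assumes "a \<in> class_one (fact y) M" "b \<in> class_one (fact y) M" "\<not> coprime a b"
  shows "\<exists>d\<in>{y<..M}. d dvd a \<and> d dvd b"
proof (intro bexI conjI)
  show "gcd a b dvd a" "gcd a b dvd b" by simp_all
  have a: "a \<ge> 1" "a \<le> M" "[a = 1] (mod fact y)" using assms(1) by (auto simp: class_one_def)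
  have "gcd a b \<noteq> 1" using assms(3) by (simp add: coprime_iff_gcd_eq_1)
  moreover have "gcd a b > 0" using a by simp
  moreover have "gcd a b = 1" if "gcd a b \<le> y"
  proof -
    have "gcd a b dvd fact y" using that \<open>gcd a b > 0\<close> by (intro dvd_fact) (simp_all add: Suc_le_eq)
    moreover have "coprime a (fact y)" using a(3) by (metis coprime_1_left cong_imp_coprime cong_sym)
    ultimately show ?thesis by (metis coprime_def gcd_dvd1 is_unit_gcd_iff nat_dvd_1_iff_1)
  qed
  moreover have "gcd a b \<le> M" using a gcd_le1_nat[of a b] by linarith
  ultimately show "gcd a b \<in> {y<..M}" by force
qed

text \<open>
  A union bound over pairs of positions and over their common divisor $d$. The modulus is the
  factorial of $2k^2$, where $k$ is the number of positions, so that the at most $k^2$ pairs, each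
  costing a proportion $\sum_{d > 2k^2} 1/d^2 \le 1/(2k^2)$, remove at most one half.
\<close>

lemma pairwise_coprime_tuples_ge:
  fixes K :: "'k set" and M :: nat
  assumes finK: "finite K" and ne: "K \<noteq> {}"
  defines "A \<equiv> class_one (fact (2 * (card K)\<^sup>2)) M"
  shows "(1/2) * (\<Sum>a\<in>A. 1 / real a) ^ card K
    \<le> (\<Sum>x | x \<in> K \<rightarrow>\<^sub>E A \<and> pairwise (\<lambda>i j. coprime (x i) (x j)) K. \<Prod>i\<in>K. 1 / real (x i))"
proof -
  let ?k = "card K"
  define y where "y = 2 * ?k\<^sup>2"
  define H where "H = (\<Sum>a\<in>A. 1 / real a)"
  let ?p = "\<lambda>x. \<Prod>i\<in>K. 1 / real (x i)"
  let ?X = "K \<rightarrow>\<^sub>E A"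
  let ?G = "{x \<in> ?X. pairwise (\<lambda>i j. coprime (x i) (x j)) K}"
  let ?E = "{(i, j). i \<in> K \<and> j \<in> K \<and> i \<noteq> j}"
  let ?B = "\<lambda>(i, j) d l. if l \<in> {i, j} then {a \<in> A. d dvd a} else A"
  have k: "?k \<ge> 1" using finK ne by (simp add: Suc_le_eq card_gt_0_iff)
  have y: "y \<ge> 1" using k by (simp add: y_def)
  have finA: "finite A" by (simp add: A_def)
  have finX: "finite ?X" using finK finA by (intro finite_PiE) auto
  have H0: "H \<ge> 0" by (auto simp: H_def intro: sum_nonneg)
  have p0: "?p x \<ge> 0" for x by (auto intro: prod_nonneg)
  have E: "finite ?E" "card ?E \<le> ?k\<^sup>2"
  proof -
    have sub: "?E \<subseteq> K \<times> K" by auto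
    show "finite ?E" using finite_subset[OF sub] finK by simp
    show "card ?E \<le> ?k\<^sup>2" using card_mono[OF _ sub] finK by (simp add: card_cartesian_product power2_eq_square)
  qed
  have total: "(\<Sum>x\<in>?X. ?p x) = H ^ ?k"
    using prod_sum_PiE[OF finK, of "\<lambda>_. A" "\<lambda>_ a. 1 / real a"] finA by (simp add: H_def)
  \<comment> \<open>Fixing a pair of positions and a common divisor leaves a product set of tuples.\<close>
  have one: "(\<Sum>x\<in>PiE K (?B e d). ?p x) \<le> H ^ ?k * (1 / (real d)\<^sup>2)"
    if e: "e \<in> ?E" and d: "d \<in> {y<..M}" for e d
  proof -
    obtain i j where ij: "e = (i, j)" "i \<in> K" "j \<in> K" "i \<noteq> j" using e by auto
    have "(\<Sum>x\<in>PiE K (?B e d). ?p x) = (\<Prod>l\<in>K. \<Sum>a\<in>?B e d l. 1 / real a)"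
      using finK finA by (subst prod_sum_PiE) (auto split: prod.splits)
    also have "\<dots> \<le> (\<Prod>l\<in>K. H * (if l \<in> {i, j} then 1 / real d else 1))"
    proof (intro prod_mono conjI)
      fix l
      show "0 \<le> (\<Sum>a\<in>?B e d l. 1 / real a)" by (auto intro: sum_nonneg)
      have "(\<Sum>a | a \<in> A \<and> d dvd a. 1 / real a) \<le> H * (1 / real d)"
        unfolding A_def H_def using d by (intro class_sum_multiples_le) auto
      then show "(\<Sum>a\<in>?B e d l. 1 / real a) \<le> H * (if l \<in> {i, j} then 1 / real d else 1)"
        using ij(1) by (auto simp: H_def)
    qed
    also have "\<dots> = H ^ ?k * (\<Prod>l\<in>K. if l \<in> {i, j} then 1 / real d else 1)"
      by (simp add: prod.distrib)
    also have "(\<Prod>l\<in>K. if l \<in> {i, j} then 1 / real d else 1) = (\<Prod>l\<in>{i, j}. 1 / real d)"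
    proof -
      have "{l \<in> K. l \<in> {i, j}} = {i, j}" using ij by auto
      then show ?thesis using prod.inter_filter[OF finK, of "\<lambda>_. 1 / real d" "\<lambda>l. l \<in> {i, j}"] by simp
    qed
    also have "\<dots> = 1 / (real d)\<^sup>2" using ij by (simp add: power2_eq_square)
    finally show ?thesis .
  qed
  have cover: "\<exists>q\<in>?E \<times> {y<..M}. x \<in> PiE K (?B (fst q) (snd q))" if x: "x \<in> ?X - ?G" for x
  proof -
    obtain i j where ij: "i \<in> K" "j \<in> K" "i \<noteq> j" "\<not> coprime (x i) (x j)"
      using x by (auto simp: pairwise_def)
    have "x i \<in> class_one (fact y) M" "x j \<in> class_one (fact y) M"
      using x ij by (auto simp: A_def y_def dest: PiE_mem)
    then obtain d where d: "d \<in> {y<..M}" "d dvd x i" "d dvd x j"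
      using common_divisor_large ij(4) by blast
    then have "x \<in> PiE K (?B (i, j) d)"
      using x by (auto simp: PiE_iff)
    then show ?thesis
      using ij d(1) by (intro bexI[of _ "((i, j), d)"]) auto
  qed
  have finB: "finite (PiE K (?B (fst q) (snd q)))" for q
    using finK finA by (intro finite_PiE) (auto split: prod.splits)
  have "(\<Sum>x\<in>?X - ?G. ?p x)
    \<le> (\<Sum>z\<in>(SIGMA q:?E \<times> {y<..M}. PiE K (?B (fst q) (snd q))). ?p (snd z))"
  proof (rule sum_le_included[where i = snd])
    show "finite (SIGMA q:?E \<times> {y<..M}. PiE K (?B (fst q) (snd q)))"
      using E(1) finB by (intro finite_SigmaI) auto
    show "\<forall>x\<in>?X - ?G. \<exists>z\<in>(SIGMA q:?E \<times> {y<..M}. PiE K (?B (fst q) (snd q))). snd z = x \<and> ?p x \<le> ?p (snd z)"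
    proof
      fix x assume "x \<in> ?X - ?G"
      from cover[OF this] obtain q where "q \<in> ?E \<times> {y<..M}" "x \<in> PiE K (?B (fst q) (snd q))" ..
      then show "\<exists>z\<in>(SIGMA q:?E \<times> {y<..M}. PiE K (?B (fst q) (snd q))). snd z = x \<and> ?p x \<le> ?p (snd z)"
        by (intro bexI[of _ "(q, x)"] SigmaI conjI) (simp_all only: fst_conv snd_conv order_refl)
    qed
  qed (use finX p0 in auto)
  also have "\<dots> = (\<Sum>q\<in>?E \<times> {y<..M}. \<Sum>x\<in>PiE K (?B (fst q) (snd q)). ?p x)"
    using E(1) finB by (subst sum.Sigma) (auto simp: case_prod_unfold)
  also have "\<dots> \<le> (\<Sum>q\<in>?E \<times> {y<..M}. H ^ ?k * (1 / (real (snd q))\<^sup>2))"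
    using one by (intro sum_mono) auto
  also have "\<dots> = real (card ?E) * (H ^ ?k * (\<Sum>d\<in>{y<..M}. 1 / (real d)\<^sup>2))"
    by (simp add: sum.cartesian_product' sum_distrib_left)
  also have "\<dots> \<le> real (?k\<^sup>2) * (H ^ ?k * (1 / real y))"
    using E(2) sum_inverse_squares_le[OF y] H0
    by (intro mult_mono of_nat_mono) (auto intro!: mult_nonneg_nonneg sum_nonneg)
  also have "\<dots> = (1/2) * H ^ ?k"
    using k by (simp add: y_def)
  finally have bad: "(\<Sum>x\<in>?X - ?G. ?p x) \<le> (1/2) * H ^ ?k" .
  have "(\<Sum>x\<in>?X. ?p x) = (\<Sum>x\<in>?X - ?G. ?p x) + (\<Sum>x\<in>?G. ?p x)"
    using finX by (intro sum.subset_diff) auto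
  with bad total show ?thesis by (simp add: H_def)
qed

section \<open>Coprime matrices as pairs of factorisations\<close>

text \<open>
  After the common entry is taken out, the rest of the row is coprime to the rest of the column.
\<close>

lemma gcd_row_column:
  fixes x :: "'a \<times> 'a \<Rightarrow> nat"
  assumes fin: "finite I" and co: "pairwise (\<lambda>p q. coprime (x p) (x q)) (I \<times> I)"
    and ij: "i \<in> I" "j \<in> I"
  shows "gcd (\<Prod>b\<in>I. x (i, b)) (\<Prod>a\<in>I. x (a, j)) = x (i, j)"
proof -
  have "coprime (\<Prod>b\<in>I - {j}. x (i, b)) (\<Prod>a\<in>I - {i}. x (a, j))"
    using co ij by (intro prod_coprime_left prod_coprime_right) (auto simp: pairwise_def)
  moreover have "(\<Prod>b\<in>I. x (i, b)) = x (i, j) * (\<Prod>b\<in>I - {j}. x (i, b))"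
    "(\<Prod>a\<in>I. x (a, j)) = x (i, j) * (\<Prod>a\<in>I - {i}. x (a, j))"
    using prod.remove[OF fin ij(2), of "\<lambda>b. x (i, b)"] prod.remove[OF fin ij(1), of "\<lambda>a. x (a, j)"]
    by simp_all
  ultimately show ?thesis
    by (simp add: gcd_mult_distrib_nat[symmetric])
qed

text \<open>
  Row and column products have the same total product, and the previous lemma makes the map from
  matrices to pairs of tuples injective; this embeds the left sum in the right one term by term.
\<close>

lemma coprime_matrices_le_diagonal:
  fixes \<nu> M N :: nat
  assumes MN: "M ^ \<nu> \<le> N" and A: "A \<subseteq> {1..M}"
  defines "I \<equiv> {..<\<nu>}"
  defines "P \<equiv> I \<rightarrow>\<^sub>E {1..N}"
  shows "(\<Sum>x | x \<in> (I \<times> I) \<rightarrow>\<^sub>E A \<and> pairwise (\<lambda>p q. coprime (x p) (x q)) (I \<times> I).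
            \<Prod>p\<in>I \<times> I. 1 / real (x p))
    \<le> (\<Sum>(f, g) | (f, g) \<in> P \<times> P \<and> prod f I = prod g I. 1 / real (prod f I))"
proof -
  let ?G = "{x \<in> (I \<times> I) \<rightarrow>\<^sub>E A. pairwise (\<lambda>p q. coprime (x p) (x q)) (I \<times> I)}"
  let ?D = "{(f, g). (f, g) \<in> P \<times> P \<and> prod f I = prod g I}"
  define row where "row x = (\<lambda>i\<in>I. \<Prod>j\<in>I. x (i, j))" for x :: "nat \<times> nat \<Rightarrow> nat"
  define col where "col x = (\<lambda>j\<in>I. \<Prod>i\<in>I. x (i, j))" for x :: "nat \<times> nat \<Rightarrow> nat"
  have finI: "finite I" by (simp add: I_def)
  have finP: "finite P" unfolding P_def using finI by (intro finite_PiE) auto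
  have finD: "finite ?D" by (rule finite_subset[of _ "P \<times> P"]) (use finP in auto)
  have prow: "prod (row x) I = (\<Prod>p\<in>I \<times> I. x p)" for x
    by (simp add: row_def prod.cartesian_product)
  have pcol: "prod (col x) I = (\<Prod>p\<in>I \<times> I. x p)" for x
  proof -
    have "(\<Prod>j\<in>I. \<Prod>i\<in>I. x (i, j)) = (\<Prod>i\<in>I. \<Prod>j\<in>I. x (i, j))"
      by (rule prod.swap)
    then show ?thesis by (simp add: col_def prod.cartesian_product)
  qed
  have bound: "(\<Prod>i\<in>I. h i) \<in> {1..N}" if "\<And>i. i \<in> I \<Longrightarrow> h i \<in> A" for h
  proof -
    have h: "1 \<le> h i" "h i \<le> M" if "i \<in> I" for i using \<open>\<And>i. i \<in> I \<Longrightarrow> h i \<in> A\<close>[OF that] A by auto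
    have "(\<Prod>i\<in>I. h i) \<le> (\<Prod>i\<in>I. M)" using h by (intro prod_mono) auto
    moreover have "(\<Prod>i\<in>I. h i) > 0" using h by (intro prod_pos) force
    ultimately show ?thesis using MN by (simp add: I_def Suc_le_eq)
  qed
  have img: "(\<lambda>x. (row x, col x)) ` ?G \<subseteq> ?D"
  proof (rule image_subsetI)
    fix x assume "x \<in> ?G"
    then have x: "x p \<in> A" if "p \<in> I \<times> I" for p using that by (auto dest: PiE_mem)
    have "row x \<in> P" "col x \<in> P"
      unfolding P_def row_def col_def restrict_PiE_iff using x by (blast intro: bound)+
    then show "(row x, col x) \<in> ?D" by (simp add: prow pcol)
  qed
  have inj: "inj_on (\<lambda>x. (row x, col x)) ?G"
  proof (rule inj_onI)
    fix x x' assume xx: "x \<in> ?G" "x' \<in> ?G" "(row x, col x) = (row x', col x')"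
    have entry: "z (i, j) = gcd (row z i) (col z j)" if "z \<in> ?G" "i \<in> I" "j \<in> I" for z i j
      using gcd_row_column[OF finI _ that(2,3), of z] that by (simp add: row_def col_def)
    have "x p = x' p" if pI: "p \<in> I \<times> I" for p
    proof -
      obtain i j where p: "p = (i, j)" "i \<in> I" "j \<in> I" using pI by auto
      show ?thesis
        unfolding p(1) entry[OF xx(1) p(2,3)] entry[OF xx(2) p(2,3)] using xx(3) by simp
    qed
    then show "x = x'" using xx by (auto intro: PiE_ext)
  qed
  have "(\<Sum>x\<in>?G. \<Prod>p\<in>I \<times> I. 1 / real (x p)) = (\<Sum>x\<in>?G. 1 / real (prod (row x) I))"
    by (simp add: prow prod_dividef)
  also have "\<dots> = (\<Sum>(f, g)\<in>(\<lambda>x. (row x, col x)) ` ?G. 1 / real (prod f I))"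
    by (simp add: sum.reindex[OF inj])
  also have "\<dots> \<le> (\<Sum>(f, g)\<in>?D. 1 / real (prod f I))"
    using img finD by (intro sum_mono2) (auto simp del: of_nat_prod)
  finally show ?thesis .
qed

lemma obtain_root_floor:
  fixes N \<nu> :: nat
  assumes "\<nu> \<ge> 1" "N \<ge> 1"
  obtains M :: nat where "M ^ \<nu> \<le> N" "ln (real N) \<le> real \<nu> * ln (real M + 1)"
proof
  define r where "r = root \<nu> (real N)"
  define M where "M = nat \<lfloor>r\<rfloor>"
  have r: "r > 0" "r ^ \<nu> = real N" using assms by (auto simp: r_def)
  have M: "real M \<le> r" "r \<le> real M + 1" using r(1) by (auto simp: M_def)
  have "real (M ^ \<nu>) \<le> real N" using power_mono[OF M(1), of \<nu>] r by simp
  then show "M ^ \<nu> \<le> N" by (simp only: of_nat_le_iff)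
  have "ln (real N) = real \<nu> * ln r" using r by (metis ln_realpow)
  also have "\<dots> \<le> real \<nu> * ln (real M + 1)" using M r(1) by (intro mult_left_mono) auto
  finally show "ln (real N) \<le> real \<nu> * ln (real M + 1)" .
qed

theorem corollary10:
  fixes \<nu> :: nat
  assumes "\<nu> \<ge> 1"
  shows "\<exists>c::real. c > 0 \<and>
    (\<forall>N::nat. N \<ge> 1 \<longrightarrow> (\<forall>T::real. T > 0 \<longrightarrow>
      c * (ln (real N)) ^ (\<nu>\<^sup>2) \<le>
        1 / (2 * T) * integral {-T..T}
          (\<lambda>t. (cmod (\<Sum>n=1..N. 1 / (of_nat n powr (1 / 2 + \<i> * of_real t)))) ^ (2 * \<nu>))))"
proof -
  define K where "K = {..<\<nu>} \<times> {..<\<nu>}"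
  define Q :: nat where "Q = fact (2 * (card K)\<^sup>2)"
  define d :: real where "d = 1 / (real \<nu> * real Q)"
  define c :: real where "c = (1/4) * d ^ (\<nu>\<^sup>2)"
  have K: "finite K" "K \<noteq> {}" "card K = \<nu>\<^sup>2"
    using assms by (auto simp: K_def card_cartesian_product power2_eq_square lessThan_empty_iff)
  have Q: "Q > 0" by (simp add: Q_def)
  have d: "d > 0" using assms Q by (simp add: d_def)
  have "c * (ln (real N)) ^ (\<nu>\<^sup>2) \<le> 1 / (2 * T) * integral {-T..T}
      (\<lambda>t. (cmod (\<Sum>n=1..N. 1 / (of_nat n powr (1 / 2 + \<i> * of_real t)))) ^ (2 * \<nu>))"
    if N: "N \<ge> 1" and T: "T > 0" for N :: nat and T :: real
  proof -
    obtain M where M: "M ^ \<nu> \<le> N" "ln (real N) \<le> real \<nu> * ln (real M + 1)"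
      using obtain_root_floor[OF assms N] .
    let ?H = "\<Sum>a\<in>class_one Q M. 1 / real a"
    have "ln (real N) \<le> real \<nu> * (real Q * ?H)"
      using M(2) ln_le_harm[of M] harm_le_class_sum[OF Q, of M]
      by (smt (verit) mult_left_mono of_nat_0_le_iff)
    then have "d * ln (real N) \<le> ?H"
      using assms Q by (simp add: d_def field_simps)
    then have "(d * ln (real N)) ^ (\<nu>\<^sup>2) \<le> ?H ^ card K"
      unfolding K(3) using N d by (intro power_mono) auto
    then have "c * (ln (real N)) ^ (\<nu>\<^sup>2) \<le> (1/2) * ((1/2) * ?H ^ card K)"
      by (simp add: c_def power_mult_distrib)
    also have "\<dots> \<le> (1/2) * (\<Sum>x | x \<in> K \<rightarrow>\<^sub>E class_one Q M \<and> pairwise (\<lambda>p q. coprime (x p) (x q)) K.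
        \<Prod>p\<in>K. 1 / real (x p))"
      unfolding Q_def by (intro mult_left_mono pairwise_coprime_tuples_ge K) auto
    also have "\<dots> \<le> (1/2) * (\<Sum>(f, g) | (f, g) \<in> ({..<\<nu>} \<rightarrow>\<^sub>E {1..N}) \<times> ({..<\<nu>} \<rightarrow>\<^sub>E {1..N})
        \<and> prod f {..<\<nu>} = prod g {..<\<nu>}. 1 / real (prod f {..<\<nu>}))"
      unfolding K_def by (intro mult_left_mono coprime_matrices_le_diagonal[OF M(1)]) (auto simp: class_one_def)
    also note power_mean_ge_diagonal[OF T]
    finally show ?thesis .
  qed
  moreover have "c > 0" using d by (simp add: c_def)
  ultimately show ?thesis by blast
qed

end
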